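(* Let $G$ be a finite simple connected graph with $m>0$ edges, maximum degree $\Delta$ and minimum degree $\delta$. Then $$\frac{F(G)}{2\sqrt{2}\,\Delta^{2}} \le DSO(G) \le \frac{1}{2\delta}\sqrt{m\,F(G)}.$$ For each of the two bounds, equality holds if and only if $G$ is regular.
   Context: For a finite simple graph $G=(V(G),E(G))$, $d_u$ denotes the degree of the vertex $u$. The Diminished Sombor index is $DSO(G)=\sum_{uv\in E(G)}\frac{\sqrt{d_u^2+d_v^2}}{d_u+d_v}$. The forgotten index is $F(G)=\sum_{uv\in E(G)}(d_u^2+d_v^2)$. *)

theory Defs
  imports Complex_Main "Graph_Theory.Digraph_Component"
begin

text \<open>
  A finite simple graph is a \<^emph>\<open>graph\<close> in the sense of the Graph_Theory library: a finite,
  symmetric, loop-free digraph without parallel arcs. Each undirected edge is thus represented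
  by two opposite arcs, which are identified in \<^emph>\<open>uedges\<close>.
\<close>

definition uedges :: "('a, 'b) pre_digraph \<Rightarrow> 'a set set" where
  "uedges G = {{u, v} | u v. u \<rightarrow>\<^bsub>G\<^esub> v}"

definition vdegree :: "('a, 'b) pre_digraph \<Rightarrow> 'a \<Rightarrow> nat" where
  "vdegree G v = card {e \<in> uedges G. v \<in> e}"

definition max_degree :: "('a, 'b) pre_digraph \<Rightarrow> nat" where
  "max_degree G = Max (vdegree G ` verts G)"

definition min_degree :: "('a, 'b) pre_digraph \<Rightarrow> nat" where
  "min_degree G = Min (vdegree G ` verts G)"

definition regular_graph :: "('a, 'b) pre_digraph \<Rightarrow> bool" where
  "regular_graph G \<longleftrightarrow> (\<exists>k. \<forall>v \<in> verts G. vdegree G v = k)"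

text \<open>
  An edge is the two-element set of its ends, so a sum over \<open>w \<in> e\<close> has
  exactly the two terms belonging to the ends of \<open>e\<close> (see \<open>sum_uedge\<close> below).
\<close>

definition DSO :: "('a, 'b) pre_digraph \<Rightarrow> real" where
  "DSO G = (\<Sum>e \<in> uedges G.
     sqrt (\<Sum>w \<in> e. (real (vdegree G w))\<^sup>2) / (\<Sum>w \<in> e. real (vdegree G w)))"

definition forgotten_index :: "('a, 'b) pre_digraph \<Rightarrow> real" where
  "forgotten_index G = (\<Sum>e \<in> uedges G. \<Sum>w \<in> e. (real (vdegree G w))\<^sup>2)"

lemma (in loopfree_digraph) sum_uedge:
  assumes "u \<rightarrow>\<^bsub>G\<^esub> v"
  shows "(\<Sum>w \<in> {u, v}. f w) = f u + (f v :: real)"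
  using assms adj_not_same by (cases "u = v") auto

lemma (in graph) vdegree_eq_out_degree: "vdegree G v = out_degree G v"
proof -
  have inc: "{e \<in> uedges G. v \<in> e} = (\<lambda>a. {v, head G a}) ` out_arcs G v"
  proof (intro equalityI subsetI)
    fix e assume "e \<in> {e \<in> uedges G. v \<in> e}"
    then obtain x where "e = {v, x}" "v \<rightarrow>\<^bsub>G\<^esub> x"
      using arcs_ends_symmetric[OF sym_arcs] by (auto simp: uedges_def insert_commute)
    then show "e \<in> (\<lambda>a. {v, head G a}) ` out_arcs G v"
      by (auto simp: arcs_ends_conv out_arcs_def)
  next
    fix e assume "e \<in> (\<lambda>a. {v, head G a}) ` out_arcs G v"
    then show "e \<in> {e \<in> uedges G. v \<in> e}"
      by (force simp: uedges_def arcs_ends_conv out_arcs_def)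
  qed
  have "inj_on (\<lambda>a. {v, head G a}) (out_arcs G v)"
  proof (rule inj_onI)
    fix a b assume *: "a \<in> out_arcs G v" "b \<in> out_arcs G v" "{v, head G a} = {v, head G b}"
    then have "head G a = head G b"
      by (auto simp: doubleton_eq_iff)
    with * show "a = b"
      by (intro no_multi_arcs) (auto simp: out_arcs_def arc_to_ends_def)
  qed
  then show ?thesis
    by (simp add: vdegree_def out_degree_def inc card_image)
qed

end

theory Submission
  imports Defs "HOL-Analysis.Convex"
begin

text \<open>
  Both bounds are obtained edge by edge. Let an edge have end degrees \<open>a\<close> and \<open>b\<close>, and put
  \<open>r = sqrt (a\<^sup>2 + b\<^sup>2)\<close>; the edge contributes \<open>r / (a + b)\<close> to DSO and \<open>r\<^sup>2\<close> to \<open>F\<close>.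

  For the lower bound, \<open>r (a + b) \<le> (sqrt 2 \<Delta>) (2 \<Delta>)\<close>, so
  \<open>r / (a + b) = r\<^sup>2 / (r (a + b)) \<ge> r\<^sup>2 / (2 sqrt 2 \<Delta>\<^sup>2)\<close>, and summation gives the claim.
  For the upper bound, \<open>r / (a + b) \<le> r / (2 \<delta>)\<close>, and the sum of the \<open>r\<close> is at most
  \<open>sqrt (m F)\<close> by the Cauchy--Schwarz inequality.

  A sum of termwise inequalities is an equality only if each of them is, which forces
  \<open>a = b = \<Delta>\<close>, respectively \<open>a = b = \<delta>\<close>, on every edge. A connected graph with an edge has no
  isolated vertex, so this condition on the edges reaches all vertices and means regularity
  (\<open>regular_graph_iff_arc_ends\<close>). Conversely, in a regular graph all edges contribute the same
  amount, and then Cauchy--Schwarz is an equality as well.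
\<close>

section \<open>The contribution of a single edge\<close>

text \<open>
  After cross-multiplication the claim is \<open>r (a + b) \<le> 2 sqrt 2 D\<^sup>2\<close> with
  \<open>r = sqrt (a\<^sup>2 + b\<^sup>2)\<close>. Unless \<open>a = b = D\<close>, the factor \<open>a + b\<close> alone is strictly below \<open>2 D\<close>,
  which makes the inequality strict.
\<close>

lemma sombor_ratio_lower:
  fixes a b D :: real
  assumes "0 < a" "0 < b" "a \<le> D" "b \<le> D"
  shows "(a\<^sup>2 + b\<^sup>2) / (2 * sqrt 2 * D\<^sup>2) \<le> sqrt (a\<^sup>2 + b\<^sup>2) / (a + b)" (is ?le)
    and "(a\<^sup>2 + b\<^sup>2) / (2 * sqrt 2 * D\<^sup>2) = sqrt (a\<^sup>2 + b\<^sup>2) / (a + b) \<longleftrightarrow> a = D \<and> b = D"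
      (is ?eq)
proof -
  define r where "r = sqrt (a\<^sup>2 + b\<^sup>2)"
  have r: "0 < r" "r\<^sup>2 = a\<^sup>2 + b\<^sup>2"
    using assms by (simp_all add: r_def sum_power2_gt_zero_iff)
  have "a\<^sup>2 + b\<^sup>2 \<le> 2 * D\<^sup>2"
    using assms power_mono[of a D 2] power_mono[of b D 2] by linarith
  then have r_le: "r \<le> sqrt 2 * D"
    using assms real_sqrt_le_mono[of "a\<^sup>2 + b\<^sup>2" "2 * D\<^sup>2"] by (simp add: r_def real_sqrt_mult)
  have lt: "r * (a + b) < 2 * sqrt 2 * D\<^sup>2" if "a + b < 2 * D"
  proof -
    have "r * (a + b) < r * (2 * D)"
      using r that by simp
    also have "\<dots> \<le> (sqrt 2 * D) * (2 * D)"
      using r_le assms by (intro mult_right_mono) auto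
    finally show ?thesis
      by (simp add: power2_eq_square mult_ac)
  qed
  have eq: "r * (a + b) = 2 * sqrt 2 * D\<^sup>2" if "a = D" "b = D"
  proof -
    have "r = sqrt 2 * D"
      using that assms by (simp add: r_def real_sqrt_mult flip: mult_2)
    then show ?thesis
      using that by (simp add: power2_eq_square)
  qed
  have c: "0 < 2 * sqrt 2 * D\<^sup>2"
    using assms by simp
  have ratio_le: "r\<^sup>2 / c \<le> r / (a + b) \<longleftrightarrow> r * (a + b) \<le> c"
    and ratio_eq: "r\<^sup>2 / c = r / (a + b) \<longleftrightarrow> r * (a + b) = c" if "0 < c" for c
  proof -
    have "r\<^sup>2 / c \<le> r / (a + b) \<longleftrightarrow> r * (r * (a + b)) \<le> r * c"
      and "r\<^sup>2 / c = r / (a + b) \<longleftrightarrow> r * (r * (a + b)) = r * c"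
      using that assms by (simp_all add: field_simps power2_eq_square)
    then show "r\<^sup>2 / c \<le> r / (a + b) \<longleftrightarrow> r * (a + b) \<le> c"
      and "r\<^sup>2 / c = r / (a + b) \<longleftrightarrow> r * (a + b) = c"
      using r(1) by simp_all
  qed
  have cases: "a + b < 2 * D \<or> a = D \<and> b = D"
    using assms by linarith
  have "r * (a + b) \<le> 2 * sqrt 2 * D\<^sup>2"
    using cases lt eq by fastforce
  then show ?le
    using ratio_le[OF c] r(2) by (simp add: r_def)
  have "r * (a + b) = 2 * sqrt 2 * D\<^sup>2 \<longleftrightarrow> a = D \<and> b = D"
    using cases lt eq by fastforce
  then show ?eq
    using ratio_eq[OF c] r(2) by (simp add: r_def)
qed

lemma sombor_ratio_upper:
  fixes a b d :: real
  assumes "0 < d" "d \<le> a" "d \<le> b"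
  shows "sqrt (a\<^sup>2 + b\<^sup>2) / (a + b) \<le> sqrt (a\<^sup>2 + b\<^sup>2) / (2 * d)"
    and "sqrt (a\<^sup>2 + b\<^sup>2) / (a + b) = sqrt (a\<^sup>2 + b\<^sup>2) / (2 * d) \<longleftrightarrow> a = d \<and> b = d"
proof -
  have "0 < sqrt (a\<^sup>2 + b\<^sup>2)"
    using assms by (simp add: sum_power2_gt_zero_iff)
  then show "sqrt (a\<^sup>2 + b\<^sup>2) / (a + b) \<le> sqrt (a\<^sup>2 + b\<^sup>2) / (2 * d)"
    and "sqrt (a\<^sup>2 + b\<^sup>2) / (a + b) = sqrt (a\<^sup>2 + b\<^sup>2) / (2 * d) \<longleftrightarrow> a = d \<and> b = d"
    using assms by (auto simp: divide_le_cancel frac_le frac_eq_eq)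
qed

section \<open>Summation\<close>

lemma sum_eq_iff_termwise:
  fixes f g :: "'a \<Rightarrow> real"
  assumes "finite A" "\<And>x. x \<in> A \<Longrightarrow> f x \<le> g x"
  shows "sum f A = sum g A \<longleftrightarrow> (\<forall>x\<in>A. f x = g x)"
  using assms sum_mono_inv[of f A g] by (auto intro: sum.cong)

lemma sum_sqrt_le_sqrt_card_mult_sum:
  fixes f :: "'a \<Rightarrow> real"
  assumes "\<And>x. x \<in> A \<Longrightarrow> 0 \<le> f x"
  shows "(\<Sum>x\<in>A. sqrt (f x)) \<le> sqrt (real (card A) * sum f A)"
proof (rule real_le_rsqrt)
  have "(\<Sum>x\<in>A. sqrt (f x))\<^sup>2 \<le> (\<Sum>x\<in>A. (sqrt (f x))\<^sup>2) * card A"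
    by (rule sum_squared_le_sum_of_squares)
  also have "\<dots> = real (card A) * sum f A"
    using assms by simp
  finally show "(\<Sum>x\<in>A. sqrt (f x))\<^sup>2 \<le> real (card A) * sum f A" .
qed

section \<open>Edges and degrees of a graph\<close>

context graph
begin

lemma finite_uedges: "finite (uedges G)"
proof (rule finite_subset)
  show "uedges G \<subseteq> Pow (verts G)"
    by (auto simp: uedges_def dest: adj_in_verts)
qed simp

lemma ball_uedges_iff: "(\<forall>e\<in>uedges G. P e) \<longleftrightarrow> (\<forall>u v. u \<rightarrow> v \<longrightarrow> P {u, v})"
  by (auto simp: uedges_def)

lemma degree_bounds:
  assumes "v \<in> verts G"
  shows "min_degree G \<le> vdegree G v" "vdegree G v \<le> max_degree G"
  using assms by (auto simp: min_degree_def max_degree_def)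

lemma vdegree_pos:
  assumes "u \<rightarrow> v"
  shows "0 < vdegree G u"
  using assms finite_uedges by (auto simp: vdegree_def uedges_def card_gt_0_iff)

text \<open>
  The two bounds need from connectedness that no vertex is isolated. This makes \<open>\<delta>\<close> positive
  and lets the equality condition reach every vertex.
\<close>

lemma connected_imp_adjacent:
  assumes "Digraph_Component.connected G" "uedges G \<noteq> {}" "v \<in> verts G"
  shows "\<exists>w. v \<rightarrow> w"
proof -
  obtain x y where xy: "x \<rightarrow> y"
    using assms(2) by (auto simp: uedges_def)
  \<comment> \<open>One end of any edge differs from \<open>v\<close>, and a walk from \<open>v\<close> to it starts with an arc.\<close>
  then obtain z where z: "z \<in> verts G" "z \<noteq> v"
    using adj_in_verts adj_not_same by metis
  have "v \<rightarrow>\<^sup>*\<^bsub>mk_symmetric G\<^esub> z"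
    using assms(1,3) z(1) by (auto simp: Digraph_Component.connected_def strongly_connected_def)
  then have "v \<rightarrow>\<^sup>* z"
    using reachable_mk_symmetric_eq[OF sym_arcs] by simp
  then show ?thesis
    using z(2) by (cases rule: converse_reachable_cases) auto
qed

text \<open>
  Translates between the equality condition that the summation yields, which concerns arcs, and
  regularity, which concerns vertices. An isolated vertex would escape the condition on arcs.
  Since \<open>k\<close> is attained as a degree, it is the only possible common degree; it is used with
  \<open>k = \<Delta>\<close> and \<open>k = \<delta>\<close>.
\<close>

lemma regular_graph_iff_arc_ends:
  assumes adjacent: "\<And>v. v \<in> verts G \<Longrightarrow> \<exists>w. v \<rightarrow> w"
    and k: "k \<in> vdegree G ` verts G"
  shows "regular_graph G \<longleftrightarrow> (\<forall>u v. u \<rightarrow> v \<longrightarrow> vdegree G u = k \<and> vdegree G v = k)"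
proof
  assume "regular_graph G"
  then show "\<forall>u v. u \<rightarrow> v \<longrightarrow> vdegree G u = k \<and> vdegree G v = k"
    using k by (auto simp: regular_graph_def dest: adj_in_verts)
next
  assume "\<forall>u v. u \<rightarrow> v \<longrightarrow> vdegree G u = k \<and> vdegree G v = k"
  then show "regular_graph G"
    using adjacent by (metis regular_graph_def)
qed

section \<open>The two bounds\<close>

theorem DSO_lower_bound:
  assumes adjacent: "\<And>v. v \<in> verts G \<Longrightarrow> \<exists>w. v \<rightarrow> w" and "verts G \<noteq> {}"
  shows "forgotten_index G / (2 * sqrt 2 * (real (max_degree G))\<^sup>2) \<le> DSO G" (is ?le)
    and "forgotten_index G / (2 * sqrt 2 * (real (max_degree G))\<^sup>2) = DSO G \<longleftrightarrow> regular_graph G"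
      (is ?eq)
proof -
  let ?d = "\<lambda>v. real (vdegree G v)"
  let ?f = "\<lambda>e. (\<Sum>w\<in>e. (?d w)\<^sup>2) / (2 * sqrt 2 * (real (max_degree G))\<^sup>2)"
  let ?g = "\<lambda>e. sqrt (\<Sum>w\<in>e. (?d w)\<^sup>2) / (\<Sum>w\<in>e. ?d w)"
  have F: "forgotten_index G / (2 * sqrt 2 * (real (max_degree G))\<^sup>2) = sum ?f (uedges G)"
    by (simp add: forgotten_index_def sum_divide_distrib)
  have D: "DSO G = sum ?g (uedges G)"
    by (simp add: DSO_def)
  have edge: "?f {u, v} \<le> ?g {u, v}"
    "?f {u, v} = ?g {u, v} \<longleftrightarrow> vdegree G u = max_degree G \<and> vdegree G v = max_degree G"
    if "u \<rightarrow> v" for u v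
  proof -
    have ends: "0 < ?d u" "0 < ?d v" "?d u \<le> max_degree G" "?d v \<le> max_degree G"
      using that adj_in_verts[OF that] degree_bounds(2) vdegree_pos adjacent by fastforce+
    show "?f {u, v} \<le> ?g {u, v}"
      "?f {u, v} = ?g {u, v} \<longleftrightarrow> vdegree G u = max_degree G \<and> vdegree G v = max_degree G"
      unfolding sum_uedge[OF that] using sombor_ratio_lower[OF ends] by simp_all
  qed
  then have le: "?f e \<le> ?g e" if "e \<in> uedges G" for e
    using that ball_uedges_iff[of "\<lambda>e. ?f e \<le> ?g e"] by blast
  show ?le
    unfolding F D by (rule sum_mono[OF le])
  have max: "max_degree G \<in> vdegree G ` verts G"
    using assms(2) unfolding max_degree_def by (intro Max_in) auto
  have termwise: "sum ?f (uedges G) = sum ?g (uedges G) \<longleftrightarrow> (\<forall>e\<in>uedges G. ?f e = ?g e)"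
    by (rule sum_eq_iff_termwise[OF finite_uedges le])
  have regular: "regular_graph G \<longleftrightarrow>
      (\<forall>u v. u \<rightarrow> v \<longrightarrow> vdegree G u = max_degree G \<and> vdegree G v = max_degree G)"
    by (rule regular_graph_iff_arc_ends[OF adjacent max])
  show ?eq
    unfolding F D termwise ball_uedges_iff regular
    using edge(2) by blast
qed

text \<open>
  The bound is a chain of two inequalities, \<open>DSO \<le> (\<Sum>r) / (2 \<delta>) \<le> sqrt (m F) / (2 \<delta>)\<close>. Equality in
  the first already characterises regularity, so for the second it is enough that regular graphs
  attain it.
\<close>

theorem DSO_upper_bound:
  assumes adjacent: "\<And>v. v \<in> verts G \<Longrightarrow> \<exists>w. v \<rightarrow> w" and "verts G \<noteq> {}"
  shows "DSO G \<le> 1 / (2 * real (min_degree G)) *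
      sqrt (real (card (uedges G)) * forgotten_index G)" (is ?le)
    and "DSO G = 1 / (2 * real (min_degree G)) *
      sqrt (real (card (uedges G)) * forgotten_index G) \<longleftrightarrow> regular_graph G" (is ?eq)
proof -
  let ?d = "\<lambda>v. real (vdegree G v)" and ?k = "real (min_degree G)"
  let ?q = "\<lambda>e. \<Sum>w\<in>e. (?d w)\<^sup>2"
  let ?f = "\<lambda>e. sqrt (?q e) / (\<Sum>w\<in>e. ?d w)" and ?g = "\<lambda>e. sqrt (?q e) / (2 * ?k)"
  let ?B = "1 / (2 * ?k) * sqrt (real (card (uedges G)) * forgotten_index G)"
  have D: "DSO G = sum ?f (uedges G)"
    by (simp add: DSO_def)
  have min: "min_degree G \<in> vdegree G ` verts G"
    using assms(2) unfolding min_degree_def by (intro Min_in) auto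
  then have k_pos: "0 < ?k"
    using adjacent vdegree_pos by fastforce
  have edge: "?f {u, v} \<le> ?g {u, v}"
    "?f {u, v} = ?g {u, v} \<longleftrightarrow> vdegree G u = min_degree G \<and> vdegree G v = min_degree G"
    if "u \<rightarrow> v" for u v
  proof -
    have ends: "?k \<le> ?d u" "?k \<le> ?d v"
      using adj_in_verts[OF that] degree_bounds(1) by simp_all
    show "?f {u, v} \<le> ?g {u, v}"
      "?f {u, v} = ?g {u, v} \<longleftrightarrow> vdegree G u = min_degree G \<and> vdegree G v = min_degree G"
      unfolding sum_uedge[OF that] using sombor_ratio_upper[OF k_pos ends] by simp_all
  qed
  then have le: "?f e \<le> ?g e" if "e \<in> uedges G" for e
    using that ball_uedges_iff[of "\<lambda>e. ?f e \<le> ?g e"] by blast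
  have first: "DSO G \<le> sum ?g (uedges G)"
    unfolding D by (rule sum_mono[OF le])
  have "(\<Sum>e\<in>uedges G. sqrt (?q e)) \<le> sqrt (real (card (uedges G)) * forgotten_index G)"
    unfolding forgotten_index_def by (intro sum_sqrt_le_sqrt_card_mult_sum sum_nonneg) simp
  then have second: "sum ?g (uedges G) \<le> ?B"
    using k_pos by (simp add: divide_right_mono flip: sum_divide_distrib)
  show ?le
    using first second by linarith
  have termwise: "sum ?f (uedges G) = sum ?g (uedges G) \<longleftrightarrow> (\<forall>e\<in>uedges G. ?f e = ?g e)"
    by (rule sum_eq_iff_termwise[OF finite_uedges le])
  have regular: "regular_graph G \<longleftrightarrow>
      (\<forall>u v. u \<rightarrow> v \<longrightarrow> vdegree G u = min_degree G \<and> vdegree G v = min_degree G)"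
    by (rule regular_graph_iff_arc_ends[OF adjacent min])
  have regular_iff: "DSO G = sum ?g (uedges G) \<longleftrightarrow> regular_graph G"
    unfolding D termwise ball_uedges_iff regular
    using edge(2) by blast
  have "sum ?g (uedges G) = ?B" if "regular_graph G"
  proof -
    have "\<forall>e\<in>uedges G. ?q e = 2 * ?k\<^sup>2"
      using that unfolding ball_uedges_iff regular
      by (simp add: sum_uedge)
    then show ?thesis
      by (simp add: forgotten_index_def real_sqrt_mult)
  qed
  then show ?eq
    using first second regular_iff by force
qed

end

theorem theorem11:
  fixes G :: "('a, 'b) pre_digraph"
  assumes "graph G"
    and "Digraph_Component.connected G"
    and "card (uedges G) > 0"
  shows "forgotten_index G / (2 * sqrt 2 * (real (max_degree G))\<^sup>2) \<le> DSO G
    \<and> DSO G \<le> 1 / (2 * real (min_degree G)) * sqrt (real (card (uedges G)) * forgotten_index G)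
    \<and> (forgotten_index G / (2 * sqrt 2 * (real (max_degree G))\<^sup>2) = DSO G \<longleftrightarrow> regular_graph G)
    \<and> (DSO G = 1 / (2 * real (min_degree G)) * sqrt (real (card (uedges G)) * forgotten_index G)
         \<longleftrightarrow> regular_graph G)"
proof -
  interpret graph G
    by fact
  have adjacent: "\<exists>w. v \<rightarrow>\<^bsub>G\<^esub> w" if "v \<in> verts G" for v
    using connected_imp_adjacent[OF assms(2) _ that] assms(3) by fastforce
  have "verts G \<noteq> {}"
    using assms(2) by (auto simp: Digraph_Component.connected_def strongly_connected_def)
  then show ?thesis
    using DSO_lower_bound[OF adjacent] DSO_upper_bound[OF adjacent] by blast
qed

end
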